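(* There exist a constant $c>0$ and an integer $n_0$ such that for every integer $n\ge n_0$, every DNNF circuit expressing the Boolean function $\mathrm{lin}_n$ has size at least $2^{cn}$. In other words, every family $\{\Gamma_n\}_{n\in\mathbb{N}}$ of DNNF circuits such that each $\Gamma_n$ expresses $\mathrm{lin}_n$ has size $2^{\Omega(n)}$.
   Context: For $n\in\mathbb{N}$, $\mathrm{lin}_n$ is the Boolean function over the variables $\{x_{i,j} : i,j\in[n],\ i<j\}$ (where $[n]=\{1,\dots,n\}$) such that an assignment $\alpha$ satisfies $\mathrm{lin}_n$ iff there exists a linear order $\prec$ on $[n]$ (irreflexive, transitive, complete) with $\alpha(x_{i,j})=1 \iff i\prec j$ for all $i<j$. Thus the models of $\mathrm{lin}_n$ correspond bijectively to the $n!$ linear orders on $[n]$. A Boolean circuit in negation normal form (NNF) is a rooted directed acyclic graph whose leaves are labelled by $\top$, $\bot$, a variable $x$ or a negated variable $\neg x$, and whose internal nodes are labelled $\wedge$ or $\vee$; it computes a Boolean function in the usual way. It is a DNNF circuit (decomposable NNF) if for every $\wedge$-node, any two of its children root subcircuits with disjoint sets of variables. A circuit expresses a Boolean function if it computes exactly that function on all assignments. The size of a circuit is its number of nodes and edges. *)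

theory Defs
  imports Complex_Main
begin

datatype 'v gate = Top | Bot | Pos 'v | Neg 'v | And | Or

fun gate_var :: "'v gate \<Rightarrow> 'v set" where
  "gate_var (Pos x) = {x}"
| "gate_var (Neg x) = {x}"
| "gate_var _ = {}"

text \<open>An edge points from a node to one of its children. Fan-in is arbitrary; parallel edges are
  not represented, as they would not affect the value of a node and only increase the size. Every
  finite circuit has an isomorphic copy with nodes of type \<open>nat\<close>; bounds meant to be uniform over all
  circuits are stated for that node type.\<close>

record ('a, 'v) circuit =
  nodes :: "'a set"
  edges :: "('a \<times> 'a) set"
  root_node :: 'a
  gate :: "'a \<Rightarrow> 'v gate"

definition nnf :: "('a, 'v) circuit \<Rightarrow> bool" where
  "nnf C \<longleftrightarrow>
     finite (nodes C) \<and> edges C \<subseteq> nodes C \<times> nodes C \<and> acyclic (edges C) \<and>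
     root_node C \<in> nodes C \<and> (\<forall>v \<in> nodes C. (root_node C, v) \<in> (edges C)\<^sup>*) \<and>
     (\<forall>v \<in> nodes C. gate C v \<in> {And, Or} \<longleftrightarrow> (\<exists>w. (v, w) \<in> edges C))"

definition vars_below :: "('a, 'v) circuit \<Rightarrow> 'a \<Rightarrow> 'v set" where
  "vars_below C v = (\<Union>u \<in> {u. (v, u) \<in> (edges C)\<^sup>*}. gate_var (gate C u))"

definition dnnf :: "('a, 'v) circuit \<Rightarrow> bool" where
  "dnnf C \<longleftrightarrow> nnf C \<and>
     (\<forall>v \<in> nodes C. gate C v = And \<longrightarrow>
        (\<forall>w w'. (v, w) \<in> edges C \<longrightarrow> (v, w') \<in> edges C \<longrightarrow> w \<noteq> w' \<longrightarrow>
           vars_below C w \<inter> vars_below C w' = {}))"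

text \<open>The set of nodes with value 1. Since the edge relation of an NNF circuit is finite and acyclic,
  the least fixed point below is the usual bottom-up evaluation.\<close>

inductive true_at :: "('a, 'v) circuit \<Rightarrow> ('v \<Rightarrow> bool) \<Rightarrow> 'a \<Rightarrow> bool"
  for C :: "('a, 'v) circuit" and \<alpha> :: "'v \<Rightarrow> bool" where
  Top: "gate C v = Top \<Longrightarrow> true_at C \<alpha> v"
| Pos: "gate C v = Pos x \<Longrightarrow> \<alpha> x \<Longrightarrow> true_at C \<alpha> v"
| Neg: "gate C v = Neg x \<Longrightarrow> \<not> \<alpha> x \<Longrightarrow> true_at C \<alpha> v"
| And: "gate C v = And \<Longrightarrow> (\<And>w. (v, w) \<in> edges C \<Longrightarrow> true_at C \<alpha> w) \<Longrightarrow> true_at C \<alpha> v"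
| Or: "gate C v = Or \<Longrightarrow> (v, w) \<in> edges C \<Longrightarrow> true_at C \<alpha> w \<Longrightarrow> true_at C \<alpha> v"

text \<open>Assignments are total on the variable type. A circuit may mention variables on which \<open>f\<close> does
  not depend, as long as its value does not depend on them either.\<close>

definition expresses :: "('a, 'v) circuit \<Rightarrow> (('v \<Rightarrow> bool) \<Rightarrow> bool) \<Rightarrow> bool" where
  "expresses C f \<longleftrightarrow> (\<forall>\<alpha>. true_at C \<alpha> (root_node C) \<longleftrightarrow> f \<alpha>)"

definition circuit_size :: "('a, 'v) circuit \<Rightarrow> nat" where
  "circuit_size C = card (nodes C) + card (edges C)"

text \<open>The pair \<open>(i, j)\<close> stands for the variable \<open>x\<^sub>i\<^sub>,\<^sub>j\<close>; only pairs with
  \<open>1 \<le> i < j \<le> n\<close> are relevant to \<open>lin n\<close>.\<close>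

definition lin :: "nat \<Rightarrow> (nat \<times> nat \<Rightarrow> bool) \<Rightarrow> bool" where
  "lin n \<alpha> \<longleftrightarrow>
     (\<exists>r. r \<subseteq> {1..n} \<times> {1..n} \<and> strict_linear_order_on {1..n} r \<and>
          (\<forall>i \<in> {1..n}. \<forall>j \<in> {1..n}. i < j \<longrightarrow> (\<alpha> (i, j) \<longleftrightarrow> (i, j) \<in> r)))"

end

theory Submission
  imports Defs "HOL-Combinatorics.Permutations"
begin

text \<open>The variables are the edges of a complete graph on \<open>n\<close> vertices, so a set of variables is a
  2-colouring of it. Take a maximal family of vertex-disjoint bichromatic triangles. If it has fewer
  than \<open>n/12\<close> members, then the remaining vertices form a monochromatic clique on more than
  \<open>3n/4\<close> vertices: the variable set is big or small. Descending from the root through nodes with a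
  big variable set, every model reaches a node that splits the models through it into a
  combinatorial rectangle whose variable partition is neither big nor small. In such a rectangle
  each of the \<open>n/12\<close> triangles excludes at least one of any three cyclically rotated orders of its
  vertices, so that it contains at most a fraction \<open>(2/3)^(n/12)\<close> of all linear orders.
  As the rectangles of all nodes together cover the \<open>n!\<close> orders, there are at least
  \<open>(3/2)^(n/12)\<close> nodes.\<close>

section \<open>Rectangles of a DNNF circuit\<close>

definition mix :: "'v set \<Rightarrow> ('v \<Rightarrow> bool) \<Rightarrow> ('v \<Rightarrow> bool) \<Rightarrow> 'v \<Rightarrow> bool" where
  "mix E \<alpha> \<beta> x = (if x \<in> E then \<alpha> x else \<beta> x)"

text \<open>\<open>v\<close> lies on a path from the root all of whose side conditions hold, so that the root becomes
  true as soon as \<open>v\<close> does.\<close>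

inductive forces_root :: "('a, 'v) circuit \<Rightarrow> ('v \<Rightarrow> bool) \<Rightarrow> 'a \<Rightarrow> bool"
  for C :: "('a, 'v) circuit" and \<alpha> :: "'v \<Rightarrow> bool" where
  Root: "forces_root C \<alpha> (root_node C)"
| Or: "forces_root C \<alpha> v \<Longrightarrow> gate C v = Or \<Longrightarrow> (v, w) \<in> edges C \<Longrightarrow> forces_root C \<alpha> w"
| And: "forces_root C \<alpha> v \<Longrightarrow> gate C v = And \<Longrightarrow> (v, w) \<in> edges C \<Longrightarrow>
    (\<And>w'. (v, w') \<in> edges C \<Longrightarrow> w' \<noteq> w \<Longrightarrow> true_at C \<alpha> w') \<Longrightarrow> forces_root C \<alpha> w"

lemma vars_below_edge: "(v, w) \<in> edges C \<Longrightarrow> vars_below C w \<subseteq> vars_below C v"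
  unfolding vars_below_def by (auto intro: converse_rtrancl_into_rtrancl)

lemma gate_var_subset_vars_below: "gate_var (gate C v) \<subseteq> vars_below C v"
  unfolding vars_below_def by auto

lemma vars_below_children:
  "vars_below C v = gate_var (gate C v) \<union> (\<Union>w \<in> {w. (v, w) \<in> edges C}. vars_below C w)"
  unfolding vars_below_def by (auto elim: converse_rtranclE intro: converse_rtrancl_into_rtrancl)

lemma true_at_cong:
  "true_at C \<alpha> v \<Longrightarrow> (\<And>x. x \<in> vars_below C v \<Longrightarrow> \<alpha> x = \<beta> x) \<Longrightarrow> true_at C \<beta> v"
proof (induction rule: true_at.induct)
  case (Pos v x)
  then show ?case using gate_var_subset_vars_below[of C v] by (auto intro: true_at.Pos)
next
  case (Neg v x)
  then show ?case using gate_var_subset_vars_below[of C v] by (auto intro: true_at.Neg)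
next
  case (And v)
  then show ?case using vars_below_edge[of v _ C] by (blast intro: true_at.And)
next
  case (Or v w)
  then show ?case using vars_below_edge[of v w C] by (blast intro: true_at.Or)
qed (rule true_at.Top)

lemma true_at_OrE:
  assumes "true_at C \<alpha> v" "gate C v = Or"
  obtains w where "(v, w) \<in> edges C" "true_at C \<alpha> w"
  using assms by (cases rule: true_at.cases) auto

lemma true_at_AndD: "true_at C \<alpha> v \<Longrightarrow> gate C v = And \<Longrightarrow> (v, w) \<in> edges C \<Longrightarrow> true_at C \<alpha> w"
  by (erule true_at.cases) auto

lemma forces_root_true: "forces_root C \<alpha> v \<Longrightarrow> true_at C \<alpha> v \<Longrightarrow> true_at C \<alpha> (root_node C)"
proof (induction rule: forces_root.induct)
  case (Or v w)
  then show ?case by (blast intro: true_at.Or)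
next
  case (And v w)
  then show ?case by (metis true_at.And)
qed

lemma forces_root_node: "nnf C \<Longrightarrow> forces_root C \<alpha> v \<Longrightarrow> v \<in> nodes C"
  by (erule forces_root.cases) (auto simp: nnf_def)

lemma dnnf_disjoint:
  assumes "dnnf C" "gate C v = And" "(v, w) \<in> edges C" "(v, w') \<in> edges C" "w \<noteq> w'"
  shows "vars_below C w \<inter> vars_below C w' = {}"
proof -
  have "v \<in> nodes C"
    using assms unfolding dnnf_def nnf_def by auto
  then show ?thesis
    using assms unfolding dnnf_def by blast
qed

text \<open>The side conditions of the path concern siblings at \<open>And\<close>-nodes. By
  decomposability these share no variable with the child on the path, hence none with the part below
  \<open>v\<close>.\<close>

lemma forces_root_cong:
  assumes "dnnf C"
  shows "forces_root C \<alpha> v \<Longrightarrow> (\<And>x. x \<notin> vars_below C v \<Longrightarrow> \<alpha> x = \<beta> x) \<Longrightarrow> forces_root C \<beta> v"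
proof (induction rule: forces_root.induct)
  case Root
  show ?case by (rule forces_root.Root)
next
  case (Or v w)
  then show ?case using vars_below_edge[of v w C] by (blast intro: forces_root.Or)
next
  case (And v w)
  have "forces_root C \<beta> v"
    using And vars_below_edge[of v w C] by blast
  moreover have "true_at C \<beta> w'" if "(v, w') \<in> edges C" "w' \<noteq> w" for w'
    using And.hyps(4)[OF that]
  proof (rule true_at_cong)
    fix x assume "x \<in> vars_below C w'"
    then have "x \<notin> vars_below C w"
      using dnnf_disjoint[OF assms And.hyps(2,3) that(1)] that(2) by auto
    then show "\<alpha> x = \<beta> x" by (rule And.prems)
  qed
  ultimately show ?case using And by (blast intro: forces_root.And)
qed

text \<open>The cut-and-paste property of a combinatorial rectangle with sides \<open>E\<close> and
  \<open>- E\<close>. The mixture only has to be a model; it need not pass through \<open>v\<close>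
  again.\<close>

definition splits :: "('a, 'v) circuit \<Rightarrow> 'a \<Rightarrow> 'v set \<Rightarrow> bool" where
  "splits C v E \<longleftrightarrow> (\<forall>\<alpha> \<beta>. forces_root C \<alpha> v \<longrightarrow> true_at C \<alpha> v \<longrightarrow> forces_root C \<beta> v \<longrightarrow>
     true_at C \<beta> v \<longrightarrow> true_at C (mix E \<alpha> \<beta>) (root_node C))"

lemma splits_vars_below:
  assumes "dnnf C"
  shows "splits C v (vars_below C v)"
  unfolding splits_def
proof (intro allI impI)
  fix \<alpha> \<beta>
  assume \<alpha>: "true_at C \<alpha> v" and \<beta>: "forces_root C \<beta> v"
  show "true_at C (mix (vars_below C v) \<alpha> \<beta>) (root_node C)"
    by (rule forces_root_true[OF forces_root_cong[OF assms \<beta>] true_at_cong[OF \<alpha>]])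
      (auto simp: mix_def)
qed

text \<open>Any group of children can be cut off, not just everything below a node: each child reads
  its variables from \<alpha> alone or from \<beta> alone, by decomposability, and the path to
  \<open>v\<close> reads \<beta>. This serves nodes whose children are all small.\<close>

lemma splits_And:
  assumes C: "dnnf C" and v: "gate C v = And" and S: "S \<subseteq> {w. (v, w) \<in> edges C}"
  shows "splits C v (\<Union>w \<in> S. vars_below C w)"
  unfolding splits_def
proof (intro allI impI)
  let ?E = "\<Union>w \<in> S. vars_below C w"
  fix \<alpha> \<beta>
  assume \<alpha>: "true_at C \<alpha> v" and \<beta>: "forces_root C \<beta> v" "true_at C \<beta> v"
  have sub: "?E \<subseteq> vars_below C v"
    using S vars_below_edge[of v _ C] by blast
  have "true_at C (mix ?E \<alpha> \<beta>) v"
    using v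
  proof (rule true_at.And)
    fix w assume w: "(v, w) \<in> edges C"
    show "true_at C (mix ?E \<alpha> \<beta>) w"
    proof (cases "w \<in> S")
      case True
      show ?thesis
        by (rule true_at_cong[OF true_at_AndD[OF \<alpha> v w]]) (use True in \<open>auto simp: mix_def\<close>)
    next
      case False
      then have "vars_below C w \<inter> ?E = {}"
        using S dnnf_disjoint[OF C v w] by blast
      then show ?thesis
        by (intro true_at_cong[OF true_at_AndD[OF \<beta>(2) v w]]) (auto simp: mix_def)
    qed
  qed
  moreover have "forces_root C (mix ?E \<alpha> \<beta>) v"
    by (rule forces_root_cong[OF C \<beta>(1)]) (use sub in \<open>auto simp: mix_def\<close>)
  ultimately show "true_at C (mix ?E \<alpha> \<beta>) (root_node C)"
    by (rule forces_root_true[rotated])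
qed

section \<open>Bichromatic triangles\<close>

text \<open>Reads an arbitrary assignment as a tournament: for distinct \<open>i\<close> and
  \<open>j\<close>, exactly one of the two directions holds, whether or not the assignment is a
  model.\<close>

definition before :: "(nat \<times> nat \<Rightarrow> bool) \<Rightarrow> nat \<Rightarrow> nat \<Rightarrow> bool" where
  "before \<alpha> i j = (if i < j then \<alpha> (i, j) else \<not> \<alpha> (j, i))"

definition edge :: "nat \<Rightarrow> nat \<Rightarrow> nat \<times> nat" where
  "edge i j = (min i j, max i j)"

lemma edge_commute: "edge i j = edge j i"
  by (simp add: edge_def min.commute max.commute)

lemma before_mix:
  "i \<noteq> j \<Longrightarrow> before (mix E \<alpha> \<beta>) i j = (if edge i j \<in> E then before \<alpha> i j else before \<beta> i j)"
  by (auto simp: before_def mix_def edge_def min_def max_def)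

lemma lin_no_cycle:
  assumes "lin n \<alpha>" "{a, b, c} \<subseteq> {1..n}" "distinct [a, b, c]"
  shows "\<not> (before \<alpha> a b \<and> before \<alpha> b c \<and> before \<alpha> c a)"
proof
  assume cycle: "before \<alpha> a b \<and> before \<alpha> b c \<and> before \<alpha> c a"
  obtain r where r: "strict_linear_order_on {1..n} r"
    "\<And>i j. i \<in> {1..n} \<Longrightarrow> j \<in> {1..n} \<Longrightarrow> i < j \<Longrightarrow> \<alpha> (i, j) \<longleftrightarrow> (i, j) \<in> r"
    using assms(1) unfolding lin_def by blast
  have before_r: "(i, j) \<in> r" if "before \<alpha> i j" "i \<in> {1..n}" "j \<in> {1..n}" "i \<noteq> j" for i j
  proof (cases "i < j")
    case True
    then show ?thesis using that r(2)[of i j] by (simp add: before_def)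
  next
    case False
    then have "(j, i) \<notin> r" using that r(2)[of j i] by (simp add: before_def)
    then show ?thesis
      using r(1) that unfolding strict_linear_order_on_def total_on_def by blast
  qed
  have "(a, b) \<in> r" "(b, c) \<in> r" "(c, a) \<in> r"
    using cycle assms(2,3) by (auto intro: before_r)
  then show False
    using r(1) unfolding strict_linear_order_on_def trans_def irrefl_def by blast
qed

definition bichromatic :: "(nat \<times> nat) set \<Rightarrow> nat \<times> nat \<times> nat \<Rightarrow> bool" where
  "bichromatic E = (\<lambda>(a, b, c). distinct [a, b, c] \<and>
     \<not> ((edge a b \<in> E \<longleftrightarrow> edge b c \<in> E) \<and> (edge b c \<in> E \<longleftrightarrow> edge c a \<in> E)))"

definition verts :: "nat \<times> nat \<times> nat \<Rightarrow> nat set" where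
  "verts = (\<lambda>(a, b, c). {a, b, c})"

lemma finite_verts [simp]: "finite (verts T)"
  by (cases T) (simp add: verts_def)

definition packing :: "nat \<Rightarrow> (nat \<times> nat) set \<Rightarrow> (nat \<times> nat \<times> nat) set \<Rightarrow> bool" where
  "packing n E \<T> \<longleftrightarrow> finite \<T> \<and> (\<forall>T \<in> \<T>. bichromatic E T \<and> verts T \<subseteq> {1..n}) \<and>
     pairwise (\<lambda>T T'. disjnt (verts T) (verts T')) \<T>"

definition balanced :: "nat \<Rightarrow> (nat \<times> nat) set \<Rightarrow> bool" where
  "balanced n E \<longleftrightarrow> (\<exists>\<T>. packing n E \<T> \<and> n \<le> 12 * card \<T>)"

text \<open>With the threshold 3/4, any two such vertex sets share more than \<open>n/2\<close>
  vertices and any three more than \<open>n/4\<close>.\<close>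

definition big :: "nat \<Rightarrow> (nat \<times> nat) set \<Rightarrow> bool" where
  "big n E \<longleftrightarrow> (\<exists>K \<subseteq> {1..n}. 3 * n < 4 * card K \<and> (\<forall>i \<in> K. \<forall>j \<in> K. i \<noteq> j \<longrightarrow> edge i j \<in> E))"

definition small :: "nat \<Rightarrow> (nat \<times> nat) set \<Rightarrow> bool" where
  "small n E \<longleftrightarrow> big n (- E)"

section \<open>Balanced, big and small variable sets, and unions of small ones\<close>

lemma card_Int_ge: "K \<subseteq> {1..n} \<Longrightarrow> L \<subseteq> {1..n} \<Longrightarrow> card K + card L \<le> card (K \<inter> L) + n" for n :: nat
proof -
  assume KL: "K \<subseteq> {1..n}" "L \<subseteq> {1..n}"
  then have fin: "finite K" "finite L"
    by (auto intro: finite_subset)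
  have "card (K \<union> L) \<le> card {1..n}"
    using KL by (intro card_mono) auto
  then show ?thesis
    using card_Un_Int[OF fin] by simp
qed

lemma two_elements:
  assumes "2 \<le> card K"
  obtains i j where "i \<in> K" "j \<in> K" "i \<noteq> j"
  using assms by (auto simp: numeral_2_eq_2 card_le_Suc_iff)

lemma three_elements:
  assumes "3 \<le> card K"
  obtains a b c where "{a, b, c} \<subseteq> K" "distinct [a, b, c]"
  using assms by (auto simp: numeral_3_eq_3 card_le_Suc_iff)

text \<open>Two edges at a common vertex have the same colour, since the triangle they span is not
  bichromatic; edges without a common vertex are compared through an edge joining them.\<close>

lemma monochromatic_clique:
  assumes mono: "\<And>a b c. {a, b, c} \<subseteq> K \<Longrightarrow> \<not> bichromatic E (a, b, c)"
  shows "(\<forall>i \<in> K. \<forall>j \<in> K. i \<noteq> j \<longrightarrow> edge i j \<in> E) \<or> (\<forall>i \<in> K. \<forall>j \<in> K. i \<noteq> j \<longrightarrow> edge i j \<in> - E)"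
proof -
  have share: "edge i j \<in> E \<longleftrightarrow> edge i k \<in> E" if "{i, j, k} \<subseteq> K" "i \<noteq> j" "i \<noteq> k" for i j k
    using mono[of j i k] that edge_commute[of i j] by (cases "j = k") (auto simp: bichromatic_def)
  have "edge i j \<in> E \<longleftrightarrow> edge k l \<in> E" if "{i, j, k, l} \<subseteq> K" "i \<noteq> j" "k \<noteq> l" for i j k l
  proof (cases "i = k")
    case True
    then show ?thesis using share[of i j l] that by auto
  next
    case False
    then show ?thesis
      using share[of i j k] share[of k i l] that edge_commute[of i k] by auto
  qed
  then show ?thesis by blast
qed

text \<open>Greedy choice: \<open>t\<close> triangles occupy at most \<open>3 * t\<close> vertices,
  and either the remaining vertices span a further bichromatic triangle or they form
  \<open>K\<close>. The inequality says that \<open>K\<close> misses at most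
  \<open>3 * (t - 1)\<close> vertices, without subtraction.\<close>

lemma packing_or_clique:
  "(\<exists>\<T>. packing n E \<T> \<and> card \<T> = t) \<or>
   (\<exists>K \<subseteq> {1..n}. n + 3 \<le> card K + 3 * t \<and>
      (\<forall>a b c. {a, b, c} \<subseteq> K \<longrightarrow> \<not> bichromatic E (a, b, c)))"
proof (induction t)
  case 0
  have "packing n E {}" by (simp add: packing_def)
  then show ?case by (intro disjI1 exI[of _ "{}"]) simp
next
  case (Suc t)
  then show ?case
  proof
    assume "\<exists>\<T>. packing n E \<T> \<and> card \<T> = t"
    then obtain \<T> where \<T>: "packing n E \<T>" "card \<T> = t" by blast
    define K where "K = {1..n} - (\<Union>T \<in> \<T>. verts T)"
    have "card (\<Union>T \<in> \<T>. verts T) \<le> (\<Sum>T \<in> \<T>. card (verts T))"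
      using \<T>(1) by (intro card_UN_le) (simp add: packing_def)
    also have "\<dots> \<le> (\<Sum>T \<in> \<T>. 3)"
      by (intro sum_mono) (auto simp: verts_def card_insert_if)
    finally have union: "card (\<Union>T \<in> \<T>. verts T) \<le> 3 * t"
      using \<T>(2) by simp
    have "n \<le> card K + card (\<Union>T \<in> \<T>. verts T)"
      unfolding K_def using diff_card_le_card_Diff[of "\<Union>T \<in> \<T>. verts T" "{1..n}"] \<T>(1)
      by (simp add: packing_def)
    with union have K: "n + 3 \<le> card K + 3 * Suc t" "K \<subseteq> {1..n}"
      by (auto simp: K_def)
    show ?thesis
    proof (cases "\<exists>a b c. {a, b, c} \<subseteq> K \<and> bichromatic E (a, b, c)")
      case True
      then obtain a b c where abc: "{a, b, c} \<subseteq> K" "bichromatic E (a, b, c)" by blast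
      have disj: "disjnt (verts (a, b, c)) (verts T)" if "T \<in> \<T>" for T
        using abc(1) that unfolding K_def by (auto simp: verts_def disjnt_def)
      \<comment> \<open>A triangle is not disjoint from itself, so the new one really increases the
        cardinality.\<close>
      then have "(a, b, c) \<notin> \<T>"
        by (fastforce simp: verts_def disjnt_def)
      moreover have "disjnt (verts T) (verts (a, b, c))" if "T \<in> \<T>" for T
        using disj[OF that] by (rule disjnt_sym)
      moreover have "verts (a, b, c) \<subseteq> {1..n}"
        using subset_trans[OF abc(1) K(2)] by (simp add: verts_def)
      ultimately have "(a, b, c) \<notin> \<T>" "packing n E (insert (a, b, c) \<T>)"
        using \<T>(1) abc(2) disj unfolding packing_def pairwise_insert by simp_all
      then show ?thesis
        using \<T> by (intro disjI1 exI[of _ "insert (a, b, c) \<T>"]) (simp add: packing_def)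
    next
      case False
      with K show ?thesis by blast
    qed
  next
    assume "\<exists>K \<subseteq> {1..n}. n + 3 \<le> card K + 3 * t \<and>
      (\<forall>a b c. {a, b, c} \<subseteq> K \<longrightarrow> \<not> bichromatic E (a, b, c))"
    then obtain K where "K \<subseteq> {1..n}" "n + 3 \<le> card K + 3 * t"
      "\<forall>a b c. {a, b, c} \<subseteq> K \<longrightarrow> \<not> bichromatic E (a, b, c)"
      by blast
    then show ?thesis by (intro disjI2 exI[of _ K]) simp
  qed
qed

lemma balanced_big_small: "1 \<le> n \<Longrightarrow> balanced n E \<or> big n E \<or> small n E"
proof -
  assume n: "1 \<le> n"
  \<comment> \<open>This is \<open>n/12\<close> rounded up. In the clique case it yields
    \<open>4 * card K\<close> at least \<open>4 * n + 12 - 12 * t\<close>, which is at least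
    \<open>3 * n + 1\<close>.\<close>
  define t where "t = (n + 11) div 12"
  from packing_or_clique[of n E t] show ?thesis
  proof (elim disjE exE conjE)
    fix \<T> assume "packing n E \<T>" "card \<T> = t"
    moreover have "n \<le> 12 * t" by (simp add: t_def)
    ultimately show ?thesis unfolding balanced_def by blast
  next
    fix K assume K: "K \<subseteq> {1..n}" "n + 3 \<le> card K + 3 * t"
      "\<forall>a b c. {a, b, c} \<subseteq> K \<longrightarrow> \<not> bichromatic E (a, b, c)"
    have "12 * t \<le> n + 11" by (simp add: t_def)
    with K(2) have "3 * n < 4 * card K" by linarith
    with K(1) monochromatic_clique[of K E] K(3) show ?thesis
      unfolding big_def small_def by blast
  qed
qed

text \<open>The three cliques would share two vertices, and the edge between these would lie in
  \<open>E\<close> or \<open>F\<close> while avoiding both.\<close>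

lemma small_Un_not_big:
  assumes "8 \<le> n" "small n E" "small n F"
  shows "\<not> big n (E \<union> F)"
proof
  assume "big n (E \<union> F)"
  with assms(2,3) obtain K L M where KLM:
    "K \<subseteq> {1..n}" "3 * n < 4 * card K" "\<forall>i \<in> K. \<forall>j \<in> K. i \<noteq> j \<longrightarrow> edge i j \<in> - E"
    "L \<subseteq> {1..n}" "3 * n < 4 * card L" "\<forall>i \<in> L. \<forall>j \<in> L. i \<noteq> j \<longrightarrow> edge i j \<in> - F"
    "M \<subseteq> {1..n}" "3 * n < 4 * card M" "\<forall>i \<in> M. \<forall>j \<in> M. i \<noteq> j \<longrightarrow> edge i j \<in> E \<union> F"
    unfolding small_def big_def by meson
  have "card K + card L \<le> card (K \<inter> L) + n" "card (K \<inter> L) + card M \<le> card (K \<inter> L \<inter> M) + n"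
    using KLM by (auto intro!: card_Int_ge)
  then have "2 \<le> card (K \<inter> L \<inter> M)"
    using KLM assms(1) by linarith
  then obtain i j where "i \<in> K \<inter> L \<inter> M" "j \<in> K \<inter> L \<inter> M" "i \<noteq> j"
    by (rule two_elements)
  then show False using KLM by blast
qed

lemma small_empty: "small n {}" if "1 \<le> n"
  unfolding small_def big_def using that by (intro exI[of _ "{1..n}"]) auto

lemma small_not_big:
  assumes "8 \<le> n" "small n E"
  shows "\<not> big n E"
  using small_Un_not_big[OF assms(1) assms(2) assms(2)] by simp

text \<open>Add the sets one at a time. A union of two small sets is never big, so the partial
  unions cannot pass from small to big without a balanced one in between.\<close>

lemma big_Union_small:
  assumes "finite S" "8 \<le> n" "\<And>w. w \<in> S \<Longrightarrow> small n (f w)" "big n (\<Union>w \<in> S. f w)"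
  shows "\<exists>S' \<subseteq> S. balanced n (\<Union>w \<in> S'. f w)"
proof (rule ccontr)
  assume no: "\<not> ?thesis"
  have "small n (\<Union>w \<in> S'. f w)" if "finite S'" "S' \<subseteq> S" for S'
    using that
  proof (induction S' rule: finite_induct)
    case empty
    then show ?case using small_empty assms(2) by simp
  next
    case (insert w S')
    then have "\<not> big n (f w \<union> (\<Union>w \<in> S'. f w))"
      using small_Un_not_big assms(2,3) by blast
    moreover have "\<not> balanced n (\<Union>w \<in> insert w S'. f w)"
      using no insert.prems by blast
    ultimately show ?case
      using balanced_big_small[of n "\<Union>w \<in> insert w S'. f w"] assms(2) by auto
  qed
  then have "small n (\<Union>w \<in> S. f w)" using assms(1) by simp
  then show False using small_not_big assms(2,4) by blast
qed

section \<open>Free variables and the descent from the root\<close>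

lemma no_free_clique:
  assumes free: "\<And>\<beta>. (\<And>x. x \<notin> F \<Longrightarrow> \<beta> x = \<alpha> x) \<Longrightarrow> lin n \<beta>"
    and K: "K \<subseteq> {1..n}" "3 \<le> card K" "\<forall>i \<in> K. \<forall>j \<in> K. i \<noteq> j \<longrightarrow> edge i j \<in> F"
  shows False
proof -
  obtain a b c where abc: "{a, b, c} \<subseteq> K" "distinct [a, b, c]"
    using three_elements[OF K(2)] by blast
  \<comment> \<open>This orients the triangle cyclically. For a listed pair that is decreasing, the
    variable is the reversed pair; it is not listed, so it is false, as the cycle demands.\<close>
  define \<beta> where "\<beta> = mix F (\<lambda>x. x \<in> {(a, b), (b, c), (c, a)}) \<alpha>"
  have "lin n \<beta>" by (rule free) (simp add: \<beta>_def mix_def)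
  moreover have "edge a b \<in> F" "edge b c \<in> F" "edge c a \<in> F"
    using abc K(3) by auto
  then have "before \<beta> a b \<and> before \<beta> b c \<and> before \<beta> c a"
    unfolding \<beta>_def using abc(2) by (simp add: before_mix) (auto simp: before_def)
  ultimately show False
    using lin_no_cycle[of n \<beta> a b c] abc K(1) by blast
qed

text \<open>The circuit need not be smooth, so a child of an \<open>Or\<close>-node may lose variables. It cannot lose
  many: the lost ones are free, but a model of \<open>lin\<close> does not stay one under arbitrary changes on a
  triangle.\<close>

lemma big_Or_child:
  assumes C: "dnnf C" "expresses C (lin n)" and n: "12 \<le> n"
    and v: "forces_root C \<alpha> v" "gate C v = Or" "big n (vars_below C v)"
    and w: "(v, w) \<in> edges C" "true_at C \<alpha> w"
  shows "\<not> small n (vars_below C w)"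
proof
  assume "small n (vars_below C w)"
  with v(3) obtain K L where KL:
    "K \<subseteq> {1..n}" "3 * n < 4 * card K" "\<forall>i \<in> K. \<forall>j \<in> K. i \<noteq> j \<longrightarrow> edge i j \<in> vars_below C v"
    "L \<subseteq> {1..n}" "3 * n < 4 * card L" "\<forall>i \<in> L. \<forall>j \<in> L. i \<noteq> j \<longrightarrow> edge i j \<in> - vars_below C w"
    unfolding small_def big_def by meson
  show False
  proof (rule no_free_clique)
    fix \<beta> assume \<beta>: "\<beta> x = \<alpha> x" if "x \<notin> vars_below C v - vars_below C w" for x
    have "forces_root C \<beta> v"
      by (rule forces_root_cong[OF C(1) v(1)]) (simp add: \<beta>)
    moreover have "true_at C \<beta> w"
      by (rule true_at_cong[OF w(2)]) (simp add: \<beta>)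
    ultimately have "true_at C \<beta> (root_node C)"
      using forces_root_true true_at.Or v(2) w(1) by metis
    then show "lin n \<beta>" using C(2) by (simp add: expresses_def)
  next
    have "card K + card L \<le> card (K \<inter> L) + n"
      using KL by (auto intro!: card_Int_ge)
    then show "3 \<le> card (K \<inter> L)" using KL n by linarith
  qed (use KL in auto)
qed

text \<open>Variables that do not occur below the root are free in every model, so they cannot
  contain a triangle.\<close>

lemma root_not_small:
  assumes "expresses C (lin n)" "lin n \<alpha>" "12 \<le> n"
  shows "\<not> small n (vars_below C (root_node C))"
proof
  assume "small n (vars_below C (root_node C))"
  then obtain K where K: "K \<subseteq> {1..n}" "3 * n < 4 * card K"
    "\<forall>i \<in> K. \<forall>j \<in> K. i \<noteq> j \<longrightarrow> edge i j \<in> - vars_below C (root_node C)"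
    unfolding small_def big_def by meson
  show False
  proof (rule no_free_clique)
    fix \<beta> assume \<beta>: "\<beta> x = \<alpha> x" if "x \<notin> - vars_below C (root_node C)" for x
    have "true_at C \<alpha> (root_node C)" using assms by (simp add: expresses_def)
    then have "true_at C \<beta> (root_node C)"
      by (rule true_at_cong) (simp add: \<beta>)
    then show "lin n \<beta>" using assms(1) by (simp add: expresses_def)
  qed (use K assms(3) in auto)
qed

text \<open>A triangle has three different edges. Hence the descent through big nodes never arrives
  at a leaf.\<close>

lemma big_not_single:
  assumes "12 \<le> n" "E \<subseteq> {x}"
  shows "\<not> big n E"
proof
  assume "big n E"
  then obtain K where K: "3 * n < 4 * card K" "\<forall>i \<in> K. \<forall>j \<in> K. i \<noteq> j \<longrightarrow> edge i j \<in> E"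
    unfolding big_def by blast
  have "3 \<le> card K" using K(1) assms(1) by linarith
  then obtain a b c where "{a, b, c} \<subseteq> K" "distinct [a, b, c]"
    by (rule three_elements)
  moreover from this have "edge a b \<in> E" "edge b c \<in> E" "edge c a \<in> E"
    using K(2) by auto
  ultimately have "edge a b = x" "edge b c = x" "edge c a = x" "distinct [a, b, c]"
    using assms(2) by auto
  then show False
    by (auto simp: edge_def min_def max_def split: if_splits)
qed

text \<open>Well-founded descent along nodes that are big, true and forcing the root. It ends at a
  child with a balanced variable set, or at an \<open>And\<close>-node with only small children,
  some of which together have a balanced one.\<close>

lemma balanced_split_below_big:
  assumes C: "dnnf C" "expresses C (lin n)" and n: "12 \<le> n"
  shows "forces_root C \<alpha> v \<Longrightarrow> true_at C \<alpha> v \<Longrightarrow> big n (vars_below C v) \<Longrightarrow>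
    \<exists>u. forces_root C \<alpha> u \<and> true_at C \<alpha> u \<and> (\<exists>E. splits C u E \<and> balanced n E)"
proof -
  have nnf: "nnf C"
    using C(1) unfolding dnnf_def by blast
  then have edges: "edges C \<subseteq> nodes C \<times> nodes C" and fin: "finite (nodes C)" and "acyclic (edges C)"
    unfolding nnf_def by blast+
  then have "wf ((edges C)\<inverse>)"
    by (meson finite_SigmaI finite_acyclic_wf_converse finite_subset)
  then show "forces_root C \<alpha> v \<Longrightarrow> true_at C \<alpha> v \<Longrightarrow> big n (vars_below C v) \<Longrightarrow>
    \<exists>u. forces_root C \<alpha> u \<and> true_at C \<alpha> u \<and> (\<exists>E. splits C u E \<and> balanced n E)"
  proof (induction v rule: wf_induct_rule)
    case (less v)
    have v: "v \<in> nodes C"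
      by (rule forces_root_node[OF nnf less(2)])
    \<comment> \<open>A child that is not small is either big, and the descent continues, or
      balanced, and it stops there.\<close>
    have go: ?case if "(v, w) \<in> edges C" "forces_root C \<alpha> w" "true_at C \<alpha> w"
        "\<not> small n (vars_below C w)" for w
    proof (cases "big n (vars_below C w)")
      case True
      then show ?thesis using less(1)[of w] that by simp
    next
      case False
      then have "balanced n (vars_below C w)"
        using balanced_big_small[of n "vars_below C w"] n that(4) by linarith
      then show ?thesis using splits_vars_below[OF C(1), of w] that(2,3) by blast
    qed
    consider "gate C v = And" | "gate C v = Or" | "gate C v \<notin> {And, Or}" by blast
    then show ?case
    proof cases
      case 1
      let ?S = "{w. (v, w) \<in> edges C}"
      have children: "forces_root C \<alpha> w \<and> true_at C \<alpha> w" if "w \<in> ?S" for w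
        using that less(2,3) 1 by (auto intro: forces_root.And true_at_AndD)
      show ?thesis
      proof (cases "\<forall>w \<in> ?S. small n (vars_below C w)")
        case True
        have "finite ?S"
          using edges by (intro finite_subset[OF _ fin]) blast
        moreover have "vars_below C v = (\<Union>w \<in> ?S. vars_below C w)"
          using vars_below_children[of C v] 1 by simp
        then have "big n (\<Union>w \<in> ?S. vars_below C w)"
          using less(4) by metis
        ultimately obtain S' where "S' \<subseteq> ?S" "balanced n (\<Union>w \<in> S'. vars_below C w)"
          using big_Union_small[of ?S n "vars_below C"] True n by force
        then show ?thesis using splits_And[OF C(1) 1, of S'] less(2,3) by blast
      next
        case False
        then obtain w where w: "w \<in> ?S" "\<not> small n (vars_below C w)" by blast
        show ?thesis by (rule go[of w]) (use w children in auto)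
      qed
    next
      case 2
      with \<open>true_at C \<alpha> v\<close> obtain w where w: "(v, w) \<in> edges C" "true_at C \<alpha> w"
        by (rule true_at_OrE)
      show ?thesis
        by (rule go[OF w(1) forces_root.Or[OF less(2) 2 w(1)] w(2)
              big_Or_child[OF C n less(2) 2 less(4) w]])
    next
      case 3
      then have "{w. (v, w) \<in> edges C} = {}"
        using nnf v unfolding nnf_def by blast
      then have "vars_below C v = gate_var (gate C v)"
        using vars_below_children[of C v] by simp
      then have "\<exists>x. vars_below C v \<subseteq> {x}"
        by (cases "gate C v") auto
      then show ?thesis using big_not_single[OF n] less(4) by blast
    qed
  qed
qed

lemma balanced_split:
  assumes C: "dnnf C" "expresses C (lin n)" and n: "12 \<le> n" and \<alpha>: "lin n \<alpha>"
  obtains v E where "v \<in> nodes C" "forces_root C \<alpha> v" "true_at C \<alpha> v" "splits C v E" "balanced n E"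
proof -
  let ?r = "root_node C"
  have root: "forces_root C \<alpha> ?r" "true_at C \<alpha> ?r"
    using C(2) \<alpha> by (auto simp: expresses_def intro: forces_root.Root)
  have "balanced n (vars_below C ?r) \<or> big n (vars_below C ?r)"
    using balanced_big_small[of n "vars_below C ?r"] n root_not_small[OF C(2) \<alpha> n] by linarith
  then have "\<exists>u. forces_root C \<alpha> u \<and> true_at C \<alpha> u \<and> (\<exists>E. splits C u E \<and> balanced n E)"
  proof
    assume "balanced n (vars_below C ?r)"
    then show ?thesis using root splits_vars_below[OF C(1), of ?r] by blast
  qed (rule balanced_split_below_big[OF C n root])
  then obtain u E where u: "forces_root C \<alpha> u" "true_at C \<alpha> u" "splits C u E" "balanced n E"
    by blast
  have "u \<in> nodes C"
    using C(1) forces_root_node[OF _ u(1)] unfolding dnnf_def by blast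
  then show thesis using u by (rule that)
qed

section \<open>Counting linear orders\<close>

text \<open>\<open>p i\<close> is the position of \<open>i\<close>. Representing orders by
  permutations makes rotating the vertices of a triangle a composition on the right.\<close>

definition order_asg :: "(nat \<Rightarrow> nat) \<Rightarrow> nat \<times> nat \<Rightarrow> bool" where
  "order_asg p = (\<lambda>(i, j). p i < p j)"

lemma lin_order_asg:
  assumes "p permutes {1..n}"
  shows "lin n (order_asg p)"
proof -
  let ?r = "{(i, j). i \<in> {1..n} \<and> j \<in> {1..n} \<and> p i < p j}"
  have "strict_linear_order_on {1..n} ?r"
    unfolding strict_linear_order_on_def
  proof (intro conjI)
    show "trans ?r" by (rule transI) auto
    show "irrefl ?r" by (simp add: irrefl_def)
    show "total_on {1..n} ?r"
      using inj_eq[OF permutes_inj[OF assms]]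
      by (simp add: total_on_def) (metis linorder_neqE_nat)
  qed
  then show ?thesis
    unfolding lin_def by (intro exI[of _ ?r]) (auto simp: order_asg_def)
qed

lemma before_order_asg: "inj p \<Longrightarrow> i \<noteq> j \<Longrightarrow> before (order_asg p) i j \<longleftrightarrow> p i < p j"
  by (auto simp: before_def order_asg_def not_less inj_eq order.order_iff_strict)

text \<open>The 3-cycle from \<open>a\<close> to \<open>b\<close> to \<open>c\<close> to
  \<open>a\<close> when these are distinct. As a product of transpositions it is a permutation for
  every triple.\<close>

definition rot :: "nat \<times> nat \<times> nat \<Rightarrow> nat \<Rightarrow> nat" where
  "rot = (\<lambda>(a, b, c). transpose a b \<circ> transpose b c)"

lemma rot_permutes: "rot T permutes verts T"
proof -
  obtain a b c where T: "T = (a, b, c)" by (cases T)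
  have "transpose a b permutes {a, b, c}" "transpose b c permutes {a, b, c}"
    by (simp_all add: permutes_swap_id)
  then show ?thesis
    unfolding T rot_def verts_def by (simp add: permutes_compose)
qed

lemma rot_apply:
  assumes "distinct [a, b, c]"
  shows "rot (a, b, c) a = b" "rot (a, b, c) b = c" "rot (a, b, c) c = a"
  using assms by (auto simp: rot_def transpose_def)

text \<open>A relaxation of membership in \<open>P\<close> to a single triangle. Unlike membership
  itself, it is unaffected by rotations of disjoint triangles, so the triangles of a packing can be
  treated one by one.\<close>

definition realised :: "(nat \<Rightarrow> nat) set \<Rightarrow> nat \<times> nat \<times> nat \<Rightarrow> (nat \<Rightarrow> nat) \<Rightarrow> bool" where
  "realised P T p \<longleftrightarrow> (\<exists>q \<in> P. \<forall>x \<in> verts T. \<forall>y \<in> verts T. p x < p y \<longleftrightarrow> q x < q y)"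

text \<open>Exactly two of \<open>p a < p b\<close>, \<open>p b < p c\<close>, \<open>p c < p a\<close> agree. Rotating the pattern suitably, these
  two sit on the two edges of the majority colour; another rotation has the same value on the third
  edge, and mixing both yields a cycle.\<close>

lemma not_all_rotations_realised:
  assumes T: "bichromatic E T" "verts T \<subseteq> {1..n}"
    and P: "\<And>q. q \<in> P \<Longrightarrow> inj q"
    and mixing: "\<And>q q'. q \<in> P \<Longrightarrow> q' \<in> P \<Longrightarrow> lin n (mix E (order_asg q) (order_asg q'))"
    and p: "inj p"
  shows "\<not> (realised P T p \<and> realised P T (p \<circ> rot T) \<and> realised P T (p \<circ> rot T \<circ> rot T))"
proof
  assume real: "realised P T p \<and> realised P T (p \<circ> rot T) \<and> realised P T (p \<circ> rot T \<circ> rot T)"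
  obtain a b c where abc: "T = (a, b, c)" by (cases T)
  have dist: "distinct [a, b, c]" "{a, b, c} \<subseteq> {1..n}"
    using T abc by (auto simp: bichromatic_def verts_def)
  define \<sigma> where "\<sigma> q = (q a < q b, q b < q c, q c < q a)" for q :: "nat \<Rightarrow> nat"
  obtain u v w where uvw: "\<sigma> p = (u, v, w)" by (cases "\<sigma> p")
  have sig: "\<exists>q \<in> P. \<sigma> q = \<sigma> p'" if "realised P T p'" for p'
    using that unfolding realised_def \<sigma>_def abc verts_def by simp metis
  have rotated: "\<sigma> (p \<circ> rot T) = (v, w, u)" "\<sigma> (p \<circ> rot T \<circ> rot T) = (w, u, v)"
    using uvw by (simp_all add: \<sigma>_def abc rot_apply[OF dist(1)])
  have "\<exists>q \<in> P. \<sigma> q = (u, v, w)" "\<exists>q \<in> P. \<sigma> q = (v, w, u)" "\<exists>q \<in> P. \<sigma> q = (w, u, v)"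
    using sig[of p] sig[of "p \<circ> rot T"] sig[of "p \<circ> rot T \<circ> rot T"] real
    unfolding uvw rotated by blast+
  then obtain q\<^sub>1 q\<^sub>2 q\<^sub>3 where q: "q\<^sub>1 \<in> P" "q\<^sub>2 \<in> P" "q\<^sub>3 \<in> P"
    "\<sigma> q\<^sub>1 = (u, v, w)" "\<sigma> q\<^sub>2 = (v, w, u)" "\<sigma> q\<^sub>3 = (w, u, v)"
    by blast
  have not_const: "\<not> (u = v \<and> v = w)"
  proof -
    have "p a \<noteq> p b" "p b \<noteq> p c" "p c \<noteq> p a"
      using dist(1) by (auto simp: inj_eq[OF p])
    moreover have "u = (p a < p b)" "v = (p b < p c)" "w = (p c < p a)"
      using uvw by (simp_all add: \<sigma>_def)
    ultimately show ?thesis by linarith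
  qed
  \<comment> \<open>Three true values form a cycle in the mixture, and three false values form the
    reversed cycle.\<close>
  have no_cycle: "\<not> (x = y \<and> y = z)"
    if "q \<in> P" "q' \<in> P" "\<sigma> q = (x\<^sub>1, y\<^sub>1, z\<^sub>1)" "\<sigma> q' = (x\<^sub>2, y\<^sub>2, z\<^sub>2)"
      "x = (if edge a b \<in> E then x\<^sub>1 else x\<^sub>2)" "y = (if edge b c \<in> E then y\<^sub>1 else y\<^sub>2)"
      "z = (if edge c a \<in> E then z\<^sub>1 else z\<^sub>2)" for q q' x y z x\<^sub>1 y\<^sub>1 z\<^sub>1 x\<^sub>2 y\<^sub>2 z\<^sub>2
  proof -
    let ?m = "mix E (order_asg q) (order_asg q')"
    have "before ?m a b = x" "before ?m b c = y" "before ?m c a = z"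
      using that dist(1) by (simp_all add: before_mix before_order_asg[OF P] \<sigma>_def)
    moreover have "before ?m b a = (\<not> before ?m a b)" "before ?m c b = (\<not> before ?m b c)"
      "before ?m a c = (\<not> before ?m c a)"
      using dist(1) by (simp_all add: before_def not_less order.order_iff_strict)
    moreover have "\<not> (before ?m a b \<and> before ?m b c \<and> before ?m c a)"
      "\<not> (before ?m a c \<and> before ?m c b \<and> before ?m b a)"
      using lin_no_cycle[OF mixing[OF that(1,2)], of a b c]
        lin_no_cycle[OF mixing[OF that(1,2)], of a c b] dist by simp_all
    ultimately show ?thesis by blast
  qed
  note cycles = no_cycle[OF _ _ _ _ refl refl refl]
  \<comment> \<open>These are all ordered pairs of different rotations. For every bichromatic
    colouring and every nonconstant pattern, one of them gives a constant triple.\<close>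
  note pairs = cycles[OF q(1,2,4,5)] cycles[OF q(1,3,4,6)] cycles[OF q(2,1,5,4)]
    cycles[OF q(2,3,5,6)] cycles[OF q(3,1,6,4)] cycles[OF q(3,2,6,5)]
  show False
    using T(1) pairs not_const unfolding abc bichromatic_def
    by (cases "edge a b \<in> E"; cases "edge b c \<in> E"; cases "edge c a \<in> E";
        cases u; cases v; cases w) simp_all
qed

text \<open>Each \<open>x\<close> has one of \<open>x\<close>, \<open>f x\<close>,
  \<open>f (f x)\<close> in \<open>X - Y\<close>. By injectivity each of these three cases accounts
  for at most \<open>card (X - Y)\<close> elements, so \<open>X - Y\<close> is at least a third of
  \<open>X\<close>.\<close>

lemma orbit_bound:
  assumes "finite X" "inj_on f X" "f ` X \<subseteq> X"
    and orbit: "\<And>x. x \<in> X \<Longrightarrow> \<not> (x \<in> Y \<and> f x \<in> Y \<and> f (f x) \<in> Y)"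
  shows "3 * card (X \<inter> Y) \<le> 2 * card X"
proof -
  define Z where "Z = X - Y"
  let ?X\<^sub>1 = "{x \<in> X. f x \<in> Z}" and ?X\<^sub>2 = "{x \<in> X. (f \<circ> f) x \<in> Z}"
  have fin: "finite Z" using assms(1) by (simp add: Z_def)
  have inj2: "inj_on (f \<circ> f) X"
    by (rule comp_inj_on[OF assms(2) inj_on_subset[OF assms(2,3)]])
  have "card ?X\<^sub>1 \<le> card Z"
    by (rule card_inj_on_le[OF inj_on_subset[OF assms(2)] _ fin]) blast+
  moreover have "card ?X\<^sub>2 \<le> card Z"
    by (rule card_inj_on_le[OF inj_on_subset[OF inj2] _ fin]) blast+
  moreover have "card X \<le> card (Z \<union> ?X\<^sub>1 \<union> ?X\<^sub>2)"
  proof (rule card_mono)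
    show "finite (Z \<union> ?X\<^sub>1 \<union> ?X\<^sub>2)" using assms(1) fin by simp
    show "X \<subseteq> Z \<union> ?X\<^sub>1 \<union> ?X\<^sub>2"
    proof
      fix x assume x: "x \<in> X"
      then have "f x \<in> X" "f (f x) \<in> X" using assms(3) by blast+
      then show "x \<in> Z \<union> ?X\<^sub>1 \<union> ?X\<^sub>2"
        using orbit[OF x] x by (simp add: Z_def)
    qed
  qed
  moreover have "card (Z \<union> ?X\<^sub>1 \<union> ?X\<^sub>2) \<le> card Z + card ?X\<^sub>1 + card ?X\<^sub>2"
    using card_Un_le[of "Z \<union> ?X\<^sub>1" ?X\<^sub>2] card_Un_le[of Z ?X\<^sub>1] by linarith
  moreover have "card Z + card (X \<inter> Y) = card X"
    unfolding Z_def using card_Diff_subset_Int[of X Y] assms(1) card_mono[of X "X \<inter> Y"] by simp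
  ultimately show ?thesis by linarith
qed

section \<open>Size of a balanced rectangle, and covering all orders\<close>

lemma card_permutes_upto: "card {p. p permutes {1..n}} = fact n" for n :: nat
  by (rule card_permutations) auto

text \<open>Every triangle costs a factor \<open>2/3\<close>: its rotation maps the orders that pass
  at the earlier, disjoint triangles to such orders, and of any three successive rotations one fails
  at the new triangle.\<close>

lemma realised_packing_bound:
  assumes "packing n E \<T>" "P \<subseteq> {p. p permutes {1..n}}"
    and mixing: "\<And>q q'. q \<in> P \<Longrightarrow> q' \<in> P \<Longrightarrow> lin n (mix E (order_asg q) (order_asg q'))"
  shows "3 ^ card \<T> * card {p. p permutes {1..n} \<and> (\<forall>T \<in> \<T>. realised P T p)} \<le> 2 ^ card \<T> * fact n"
proof -
  have "finite \<T>" using assms(1) by (simp add: packing_def)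
  then show ?thesis using assms(1)
  proof (induction \<T> rule: finite_induct)
    case empty
    then show ?case using card_permutes_upto[of n] by simp
  next
    case (insert T \<T>)
    let ?X = "{p. p permutes {1..n} \<and> (\<forall>T \<in> \<T>. realised P T p)}"
    let ?f = "\<lambda>p. p \<circ> rot T"
    have T: "bichromatic E T" "verts T \<subseteq> {1..n}"
      and pack: "packing n E \<T>"
      using insert.prems by (simp_all add: packing_def pairwise_insert)
    have disj: "verts T \<inter> verts T' = {}" if "T' \<in> \<T>" for T'
      using insert.prems insert.hyps(2) that
      unfolding packing_def pairwise_insert disjnt_def by metis
    have same: "realised P T' (?f p) = realised P T' p" if "T' \<in> \<T>" for T' p
    proof -
      have "rot T x = x" if "x \<in> verts T'" for x
        using permutes_not_in[OF rot_permutes] disj \<open>T' \<in> \<T>\<close> that by blast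
      then show ?thesis by (simp add: realised_def)
    qed
    have "3 * card (?X \<inter> {p. realised P T p}) \<le> 2 * card ?X"
    proof (rule orbit_bound[where f = ?f])
      show "finite ?X" by (rule finite_subset[OF _ finite_permutations[of "{1..n}"]]) auto
      have "surj (rot T)" using rot_permutes permutes_surj by blast
      then show "inj_on ?f ?X"
        by (intro inj_onI) (metis (no_types, lifting) comp_assoc comp_id surj_iff)
      show "?f ` ?X \<subseteq> ?X"
        using same permutes_compose[OF permutes_subset[OF rot_permutes T(2)]] by auto
      show "\<not> (p \<in> {p. realised P T p} \<and> ?f p \<in> {p. realised P T p} \<and>
          ?f (?f p) \<in> {p. realised P T p})" if "p \<in> ?X" for p
        using not_all_rotations_realised[OF T _ mixing, where p = p] that assms(2)
        by (auto dest: permutes_inj)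
    qed
    moreover have "?X \<inter> {p. realised P T p} =
        {p. p permutes {1..n} \<and> (\<forall>T \<in> insert T \<T>. realised P T p)}"
      by auto
    ultimately have "3 * card {p. p permutes {1..n} \<and> (\<forall>T \<in> insert T \<T>. realised P T p)} \<le> 2 * card ?X"
      by simp
    then have "3 ^ card \<T> * (3 * card {p. p permutes {1..n} \<and> (\<forall>T \<in> insert T \<T>. realised P T p)})
        \<le> 3 ^ card \<T> * (2 * card ?X)"
      by (rule mult_left_mono) simp
    also have "\<dots> \<le> 2 * (2 ^ card \<T> * fact n)"
      using insert.IH[OF pack] by simp
    finally show ?case using insert.hyps by (simp add: mult.assoc mult.left_commute)
  qed
qed

text \<open>Each member of \<open>P\<close> is its own witness for \<open>realised\<close> at every
  triangle. As \<open>2/3\<close> is below 1, the exponent \<open>card \<T>\<close> may be lowered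
  to \<open>n / 12\<close>.\<close>

lemma mixing_orders_bound:
  assumes "balanced n E" "P \<subseteq> {p. p permutes {1..n}}"
    and "\<And>q q'. q \<in> P \<Longrightarrow> q' \<in> P \<Longrightarrow> lin n (mix E (order_asg q) (order_asg q'))"
  shows "real (card P) \<le> (2/3) powr (real n / 12) * fact n"
proof -
  obtain \<T> where \<T>: "packing n E \<T>" "n \<le> 12 * card \<T>"
    using assms(1) unfolding balanced_def by blast
  let ?Q = "{p. p permutes {1..n} \<and> (\<forall>T \<in> \<T>. realised P T p)}"
  have "card P \<le> card ?Q"
  proof (rule card_mono)
    show "finite ?Q" by (rule finite_subset[OF _ finite_permutations[of "{1..n}"]]) auto
    show "P \<subseteq> ?Q" using assms(2) by (auto simp: realised_def)
  qed
  then have "3 ^ card \<T> * card P \<le> 2 ^ card \<T> * fact n"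
    using realised_packing_bound[OF \<T>(1) assms(2,3)] by (meson le_trans mult_le_mono2)
  then have "real (3 ^ card \<T> * card P) \<le> real (2 ^ card \<T> * fact n)"
    by (rule of_nat_mono)
  then have "real (card P) \<le> (2/3) ^ card \<T> * fact n"
    by (simp add: field_simps)
  also have "(2/3 :: real) ^ card \<T> = (2/3) powr real (card \<T>)"
    by (simp add: powr_realpow)
  also have "\<dots> \<le> (2/3) powr (real n / 12)"
    using \<T>(2) by (intro powr_mono') auto
  finally show ?thesis by simp
qed

lemma dnnf_lin_bound:
  assumes C: "dnnf C" "expresses C (lin n)" and n: "12 \<le> n"
  shows "(3/2) powr (real n / 12) \<le> real (card (nodes C))"
proof -
  \<comment> \<open>Whether a node has a balanced split does not depend on the model, so one set
    \<open>E\<close> bounds all orders through that node.\<close>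
  define V where "V = {v \<in> nodes C. \<exists>E. splits C v E \<and> balanced n E}"
  define P where "P v = {p. p permutes {1..n} \<and> forces_root C (order_asg p) v \<and>
    true_at C (order_asg p) v}" for v
  have fin: "finite (nodes C)" using C(1) by (simp add: dnnf_def nnf_def)
  then have finV: "finite V" by (simp add: V_def)
  have P_fin: "finite (P v)" for v
    by (rule finite_subset[OF _ finite_permutations[of "{1..n}"]]) (auto simp: P_def)
  have P_bound: "real (card (P v)) \<le> (2/3) powr (real n / 12) * fact n" if v: "v \<in> V" for v
  proof -
    obtain E where E: "splits C v E" "balanced n E" using v by (auto simp: V_def)
    show ?thesis
      by (rule mixing_orders_bound[OF E(2)])
        (use C(2) E(1) in \<open>auto simp: P_def splits_def expresses_def\<close>)
  qed
  have "{p. p permutes {1..n}} \<subseteq> (\<Union>v \<in> V. P v)"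
  proof
    fix p assume "p \<in> {p. p permutes {1..n}}"
    then have p: "p permutes {1..n}" by simp
    show "p \<in> (\<Union>v \<in> V. P v)"
      using balanced_split[OF C n lin_order_asg[OF p]] p unfolding V_def P_def by blast
  qed
  then have "card {p. p permutes {1..n}} \<le> card (\<Union>v \<in> V. P v)"
    using finV P_fin by (intro card_mono) auto
  also have "\<dots> \<le> (\<Sum>v \<in> V. card (P v))"
    by (rule card_UN_le[OF finV])
  finally have "fact n \<le> (\<Sum>v \<in> V. card (P v))"
    unfolding card_permutes_upto .
  then have "real (fact n) \<le> real (\<Sum>v \<in> V. card (P v))"
    by (rule of_nat_mono)
  also have "\<dots> \<le> (\<Sum>v \<in> V. (2/3) powr (real n / 12) * fact n)"
    unfolding of_nat_sum by (intro sum_mono P_bound)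
  also have "\<dots> = real (card V) * (2/3) powr (real n / 12) * fact n"
    by simp
  finally have "1 \<le> real (card V) * (2/3) powr (real n / 12)"
    by simp
  then have "(3/2) powr (real n / 12) * 1 \<le>
      (3/2) powr (real n / 12) * (real (card V) * (2/3) powr (real n / 12))"
    by (intro mult_left_mono) auto
  also have "\<dots> = real (card V) * ((3/2) powr (real n / 12) * (2/3) powr (real n / 12))"
    by simp
  also have "(3/2) powr (real n / 12) * (2/3) powr (real n / 12) = 1"
    by (simp flip: powr_mult)
  finally have "(3/2) powr (real n / 12) \<le> real (card V)"
    by simp
  moreover have "card V \<le> card (nodes C)"
    using fin by (intro card_mono) (auto simp: V_def)
  ultimately show ?thesis by linarith
qed

theorem theorem1:
  "\<exists>c :: real. c > 0 \<and> (\<exists>n\<^sub>0 :: nat. \<forall>n \<ge> n\<^sub>0. \<forall>C :: (nat, nat \<times> nat) circuit.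
     dnnf C \<longrightarrow> expresses C (lin n) \<longrightarrow> real (circuit_size C) \<ge> 2 powr (c * real n))"
proof (intro exI conjI allI impI)
  \<comment> \<open>This \<open>c\<close> turns \<open>2 powr (c * n)\<close> into
    \<open>(3/2) powr (n / 12)\<close>, the bound on the number of nodes alone.\<close>
  show "log 2 (3/2) / 12 > (0 :: real)" by simp
  fix n :: nat and C :: "(nat, nat \<times> nat) circuit"
  assume n: "12 \<le> n" and C: "dnnf C" "expresses C (lin n)"
  have "2 powr (log 2 (3/2) / 12 * real n) = (2 powr log 2 (3/2)) powr (real n / 12)"
    unfolding powr_powr by simp
  also have "\<dots> = (3/2) powr (real n / 12)"
    by simp
  also have "\<dots> \<le> real (card (nodes C))"
    by (rule dnnf_lin_bound[OF C n])
  finally show "2 powr (log 2 (3/2) / 12 * real n) \<le> real (circuit_size C)"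
    by (simp add: circuit_size_def)
qed

end
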